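(* Let $L>0$ and $\sigma\ge0$. Let $\mathcal D\subset\mathbb R^d$ be an open set and assume that $|\nabla f(x)|^2\ge2Lf(x)$ for all $x\in\mathcal D$. Moreover, for $n\in\mathbb N_0$, let $\mathbb A_n=\{X_i\in\mathcal D\text{ for all }i=0,\dots,n\}$ and assume that $$\mathbb E[|D_{n+1}|^2\mid\mathcal F_n]\le\sigma f(X_n)\quad\text{on }\mathbb A_n.$$ There exists $\bar\gamma>0$ such that if $\sup_{n\in\mathbb N}\gamma_n\le\bar\gamma$ there holds: (i) There exist $C,m>0$ such that for all $n\in\mathbb N$ we have $$\mathbb E[\mathbf 1_{\mathbb A_{n-1}}f(X_n)]\le C\exp(-mt_n),\qquad\text{where }t_n=\sum_{i=1}^n\gamma_i.$$ (ii) Let $m'<m$ and assume that $\sum_{i=0}^\infty\exp((m'-m)t_i)<\infty$. Then, on $\mathbb A_\infty=\bigcap_{n\in\mathbb N_0}\mathbb A_n$, we have $\exp(m't_n)f(X_n)\to0$ almost surely. (iii) The process $(X_n)_{n\in\mathbb N_0}$ converges almost surely on $\mathbb A_\infty$.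
   Context: Setting. $f:\mathbb R^d\to\mathbb R$ is differentiable with $C_L$-Lipschitz continuous gradient for some constant $C_L\ge0$, and $\inf_{x\in\mathbb R^d}f(x)=0$. On a filtered probability space $(\Omega,(\mathcal F_n)_{n\in\mathbb N_0},\mathcal F,\mathbb P)$, $(X_n)_{n\in\mathbb N_0}$ and $(V_n)_{n\in\mathbb N_0}$ are $(\mathcal F_n)$-adapted $\mathbb R^d$-valued processes (momentum stochastic gradient descent, MSGD) satisfying, for all $n\in\mathbb N_0$, $$X_{n+1}=X_n+\gamma_{n+1}V_{n+1},\qquad V_{n+1}=V_n-\gamma_{n+1}\mu V_n-\gamma_{n+1}\nabla f(X_n)+\gamma_{n+1}D_{n+1},$$ where $X_0,V_0\in L^2(\Omega,\mathcal F_0)$, $(\gamma_n)_{n\in\mathbb N}$ is a sequence of strictly positive reals (step-sizes), $\mu>0$ (friction parameter), and $(D_n)_{n\in\mathbb N}$ is a sequence of $L^2$-martingale differences with respect to $(\mathcal F_n)_{n\in\mathbb N_0}$. By convention $t_0=0$. *)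

theory Defs
  imports "HOL-Probability.Probability"
begin

locale filtered_prob_space = prob_space M + filtration "space M" F
  for M :: "'w measure" and F :: "nat \<Rightarrow> 'w measure" +
  assumes subalg: "\<And>n. subalgebra M (F n)"

definition L2_random_vector :: "'w measure \<Rightarrow> 'w measure \<Rightarrow> ('w \<Rightarrow> real ^ 'd) \<Rightarrow> bool" where
  "L2_random_vector M G Y \<longleftrightarrow>
     Y \<in> borel_measurable G \<and> integrable M (\<lambda>\<omega>. (norm (Y \<omega>))\<^sup>2)"

(* The library only has conditional expectations of real-valued random variables. *)
definition vec_cond_exp ::
  "'w measure \<Rightarrow> 'w measure \<Rightarrow> ('w \<Rightarrow> real ^ 'd) \<Rightarrow> 'w \<Rightarrow> real ^ 'd" where
  "vec_cond_exp M G Y = (\<lambda>\<omega>. \<chi> i. real_cond_exp M G (\<lambda>\<omega>'. Y \<omega>' $ i) \<omega>)"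

(* Sequences indexed from 1 are functions on nat whose value at 0 is irrelevant. *)
definition L2_martingale_differences ::
  "'w measure \<Rightarrow> (nat \<Rightarrow> 'w measure) \<Rightarrow> (nat \<Rightarrow> 'w \<Rightarrow> real ^ 'd) \<Rightarrow> bool" where
  "L2_martingale_differences M F D \<longleftrightarrow>
     (\<forall>n\<ge>1. L2_random_vector M (F n) (D n)) \<and>
     (\<forall>n. AE \<omega> in M. vec_cond_exp M (F n) (D (Suc n)) \<omega> = 0)"

locale msgd = filtered_prob_space M F
  for M :: "'w measure" and F :: "nat \<Rightarrow> 'w measure" +
  fixes grad :: "real ^ 'd \<Rightarrow> real ^ 'd"
    and \<mu> :: real
    and \<gamma> :: "nat \<Rightarrow> real"
    and D X V :: "nat \<Rightarrow> 'w \<Rightarrow> real ^ 'd"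
  assumes friction_pos: "\<mu> > 0"
    and step_pos: "\<And>n. n \<ge> 1 \<Longrightarrow> \<gamma> n > 0"
    and noise: "L2_martingale_differences M F D"
    and X_adapted: "\<And>n. X n \<in> borel_measurable (F n)"
    and V_adapted: "\<And>n. V n \<in> borel_measurable (F n)"
    and X_init: "L2_random_vector M (F 0) (X 0)"
    and V_init: "L2_random_vector M (F 0) (V 0)"
    and X_step: "\<And>n. AE \<omega> in M. X (Suc n) \<omega> = X n \<omega> + \<gamma> (Suc n) *\<^sub>R V (Suc n) \<omega>"
    and V_step: "\<And>n. AE \<omega> in M. V (Suc n) \<omega> =
          V n \<omega> - (\<gamma> (Suc n) * \<mu>) *\<^sub>R V n \<omega> - \<gamma> (Suc n) *\<^sub>R grad (X n \<omega>)
            + \<gamma> (Suc n) *\<^sub>R D (Suc n) \<omega>"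

definition stays_in ::
  "'w measure \<Rightarrow> (real ^ 'd) set \<Rightarrow> (nat \<Rightarrow> 'w \<Rightarrow> real ^ 'd) \<Rightarrow> nat \<Rightarrow> 'w set" where
  "stays_in M \<D> X n = {\<omega> \<in> space M. \<forall>i\<le>n. X i \<omega> \<in> \<D>}"

definition time :: "(nat \<Rightarrow> real) \<Rightarrow> nat \<Rightarrow> real" where
  "time \<gamma> n = (\<Sum>i=1..n. \<gamma> i)"

end

theory Submission
  imports Defs
begin

text \<open>
  With \<open>b\<close> large and \<open>a = \<mu> + 2 b\<close>, the function \<open>a f(x) + grad x \<bullet> v + b |v|\<^sup>2\<close> dominates
  \<open>f(x) + |v|\<^sup>2\<close> and, by the Polyak--Lojasiewicz inequality, contracts in expectation by a factor
  \<open>1 - m \<gamma>\<close> in each step that starts in \<open>\<D>\<close>, provided the step size is small. Hence \<open>f(X\<^sub>n)\<close> and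
  \<open>|V\<^sub>n|\<^sup>2\<close>, restricted to the event of not having left \<open>\<D>\<close>, decay in mean like \<open>exp (- m t\<^sub>n)\<close>.
  The almost sure statements follow because series of nonnegative random variables with summable
  means converge almost surely: apply this to \<open>exp (m' t\<^sub>n) f(X\<^sub>n)\<close> and to the increments
  \<open>\<gamma>\<^sub>n |V\<^sub>n|\<close> of \<open>X\<close>.
\<close>

section \<open>Functions with Lipschitz gradient\<close>

text \<open>This is the descent lemma of smooth optimisation, proved without integration: along the
  segment, \<open>f\<close> minus the claimed linear and quadratic terms has nonpositive derivative,
  by Cauchy-Schwarz and the Lipschitz bound.\<close>

lemma gderiv_lipschitz_descent:
  fixes f :: "'a::real_inner \<Rightarrow> real"
  assumes deriv: "\<And>x. GDERIV f x :> grad x" and lip: "K-lipschitz_on UNIV grad"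
  shows "f y \<le> f x + grad x \<bullet> (y - x) + K / 2 * (norm (y - x))\<^sup>2"
proof -
  define h where "h = y - x"
  define p where "p t = f (x + t *\<^sub>R h) - t * (grad x \<bullet> h) - K / 2 * t\<^sup>2 * (norm h)\<^sup>2" for t
  have "p 1 \<le> p 0"
  proof (rule DERIV_nonpos_imp_nonincreasing[where f = p and a = 0 and b = 1])
    fix t :: real assume t: "0 \<le> t" "t \<le> 1"
    have "((\<lambda>s. f (x + s *\<^sub>R h)) has_derivative (\<lambda>s. (s *\<^sub>R h) \<bullet> grad (x + t *\<^sub>R h))) (at t)"
      using deriv[of "x + t *\<^sub>R h"] unfolding gderiv_def
      by (intro has_derivative_compose[where f="\<lambda>s. x + s *\<^sub>R h" and g=f])
         (auto intro!: derivative_eq_intros)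
    then have f': "((\<lambda>s. f (x + s *\<^sub>R h)) has_real_derivative grad (x + t *\<^sub>R h) \<bullet> h) (at t)"
      by (rule has_derivative_imp_has_field_derivative) (simp add: inner_commute mult.commute)
    have "(p has_real_derivative
        grad (x + t *\<^sub>R h) \<bullet> h - grad x \<bullet> h - K * t * (norm h)\<^sup>2) (at t)"
      unfolding p_def by (rule derivative_eq_intros f' refl | simp)+
    moreover have "grad (x + t *\<^sub>R h) \<bullet> h - grad x \<bullet> h \<le> K * t * (norm h)\<^sup>2"
    proof -
      have "norm (grad (x + t *\<^sub>R h) - grad x) \<le> K * (t * norm h)"
        using lipschitz_onD[OF lip, of "x + t *\<^sub>R h" x] t by (simp add: dist_norm)
      then have "norm (grad (x + t *\<^sub>R h) - grad x) * norm h \<le> K * (t * norm h) * norm h"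
        by (intro mult_right_mono) auto
      then show ?thesis
        using norm_cauchy_schwarz[of "grad (x + t *\<^sub>R h) - grad x" h]
        by (simp add: inner_diff_left power2_eq_square mult.assoc)
    qed
    ultimately show "\<exists>d. (p has_real_derivative d) (at t) \<and> d \<le> 0"
      by fastforce
  qed simp
  then show ?thesis by (simp add: p_def h_def)
qed

text \<open>A gradient step of length \<open>1 / K\<close> lowers \<open>f\<close> by at least
  \<open>(norm (grad x))\<^sup>2 / (2 * K)\<close>, and it cannot take \<open>f\<close> below
  0.\<close>

lemma gderiv_lipschitz_norm_le:
  fixes f :: "'a::real_inner \<Rightarrow> real"
  assumes deriv: "\<And>x. GDERIV f x :> grad x" and lip: "K-lipschitz_on UNIV grad"
    and "K > 0" and nonneg: "\<And>x. f x \<ge> 0"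
  shows "(norm (grad x))\<^sup>2 \<le> 2 * K * f x"
proof -
  define y where "y = x - (1 / K) *\<^sub>R grad x"
  have "0 \<le> f y" by (rule nonneg)
  also have "\<dots> \<le> f x + grad x \<bullet> (y - x) + K / 2 * (norm (y - x))\<^sup>2"
    by (rule gderiv_lipschitz_descent[OF deriv lip])
  also have "\<dots> = f x - (norm (grad x))\<^sup>2 / (2 * K)"
    using \<open>K > 0\<close>
    by (simp add: y_def power2_norm_eq_inner[symmetric] power_mult_distrib power2_eq_square field_simps)
  finally show ?thesis using \<open>K > 0\<close> by (simp add: field_simps)
qed

section \<open>The Lyapunov function\<close>

text \<open>The value and the gradient of the objective enter as a number and a vector, so that the
  estimates below are pure inner-product algebra in \<open>\<phi>\<close>, \<open>g\<close> and
  \<open>v\<close>.\<close>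

definition lyapunov :: "real \<Rightarrow> real \<Rightarrow> real \<Rightarrow> 'a \<Rightarrow> 'a::real_inner \<Rightarrow> real" where
  "lyapunov a b \<phi> g v = a * \<phi> + g \<bullet> v + b * (norm v)\<^sup>2"

lemma lyapunov_lower:
  assumes "(norm g)\<^sup>2 \<le> 2 * K * \<phi>" and "b > 0" and "2 * K \<le> a * b" and "0 \<le> \<phi>"
  shows "a / 2 * \<phi> + b / 2 * (norm v)\<^sup>2 \<le> lyapunov a b \<phi> g v"
proof -
  \<comment> \<open>Completing the square absorbs the cross term into half of each diagonal term;
    the gradient bound together with \<open>2 * K \<le> a * b\<close> trades the square of
    \<open>g\<close> for \<open>a * b * \<phi>\<close>.\<close>
  have "0 \<le> (norm (g + b *\<^sub>R v))\<^sup>2" by simp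
  also have "\<dots> = (norm g)\<^sup>2 + 2 * b * (g \<bullet> v) + b\<^sup>2 * (norm v)\<^sup>2"
    unfolding power2_norm_eq_inner
    by (simp add: inner_add inner_commute power2_eq_square algebra_simps)
  also have "\<dots> \<le> a * b * \<phi> + 2 * b * (g \<bullet> v) + b\<^sup>2 * (norm v)\<^sup>2"
    using assms(1) mult_right_mono[OF assms(3,4)] by linarith
  also have "\<dots> = b * (a * \<phi> + 2 * (g \<bullet> v) + b * (norm v)\<^sup>2)"
    by (simp add: algebra_simps power2_eq_square)
  finally show ?thesis
    using \<open>b > 0\<close> by (simp add: zero_le_mult_iff lyapunov_def)
qed

text \<open>
  The choice \<open>a = \<mu> + 2 b\<close> cancels the cross term \<open>g \<bullet> v\<close> at first order in the step size.
\<close>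

lemma lyapunov_expansion:
  fixes g v :: "'a::real_inner"
  defines "x \<equiv> g \<bullet> v" and "G \<equiv> (norm g)\<^sup>2" and "y \<equiv> (norm v)\<^sup>2"
  assumes "w = (1 - \<gamma> * \<mu>) *\<^sub>R v - \<gamma> *\<^sub>R g" and "a = \<mu> + 2 * b"
    and "q = a * K / 2 * \<gamma>\<^sup>2 + K * \<gamma> + b"
  shows "a * \<phi> + (a * \<gamma> + 1) * (g \<bullet> w) + q * ((norm w)\<^sup>2 + \<gamma>\<^sup>2 * (\<sigma> * \<phi>)) =
    lyapunov a b \<phi> g v - \<gamma> * (G + (2 * b * \<mu> - K) * y) +
    \<gamma>\<^sup>2 * (- a * (\<mu> * x + G) + b * (\<mu>\<^sup>2 * y + 2 * \<mu> * x + G)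
      + K * (- 2 * \<mu> * y + \<gamma> * \<mu>\<^sup>2 * y - 2 * (1 - \<gamma> * \<mu>) * x + \<gamma> * G)
      + a * K / 2 * ((1 - \<gamma> * \<mu>)\<^sup>2 * y - 2 * \<gamma> * (1 - \<gamma> * \<mu>) * x + \<gamma>\<^sup>2 * G)
      + q * (\<sigma> * \<phi>))"
proof -
  have gw: "g \<bullet> w = (1 - \<gamma> * \<mu>) * x - \<gamma> * G"
    unfolding assms by (simp add: inner_diff power2_norm_eq_inner)
  have ww: "(norm w)\<^sup>2 = (1 - \<gamma> * \<mu>)\<^sup>2 * y - 2 * \<gamma> * (1 - \<gamma> * \<mu>) * x + \<gamma>\<^sup>2 * G"
    unfolding assms power2_norm_eq_inner
    by (simp add: inner_diff inner_commute power2_eq_square algebra_simps)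
  show ?thesis
    unfolding gw ww lyapunov_def assms(6) x_def[symmetric] y_def[symmetric] assms(5)
    by (simp add: field_simps power2_eq_square power3_eq_cube power4_eq_xxxx)
qed

text \<open>The left side is the bound of one step once the noise has been averaged out. To first
  order in the step size it dissipates at least \<open>c * (\<phi> + y)\<close>; the second-order
  remainder is at most \<open>C2 * (\<phi> + y)\<close>, and a small step lets half of the
  dissipation pay for it. Comparing the other half with an upper bound of the Lyapunov function
  gives the rate \<open>m\<close>.\<close>

lemma lyapunov_drift:
  fixes K \<mu> L \<sigma> :: real
  assumes pos: "K > 0" "\<mu> > 0" "L > 0" and "\<sigma> \<ge> 0"
    and "b > 0" and a: "a = \<mu> + 2 * b" and gap: "K < 2 * b * \<mu>"
  obtains m \<delta> where "m > 0" "\<delta> > 0"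
    and "\<And>\<gamma> \<phi> (g :: 'a::real_inner) v. \<lbrakk>0 < \<gamma>; \<gamma> \<le> \<delta>; 0 \<le> \<phi>; 2 * L * \<phi> \<le> (norm g)\<^sup>2; (norm g)\<^sup>2 \<le> 2 * K * \<phi>\<rbrakk>
      \<Longrightarrow> a * \<phi> + (a * \<gamma> + 1) * (g \<bullet> ((1 - \<gamma> * \<mu>) *\<^sub>R v - \<gamma> *\<^sub>R g))
            + (a * K / 2 * \<gamma>\<^sup>2 + K * \<gamma> + b)
              * ((norm ((1 - \<gamma> * \<mu>) *\<^sub>R v - \<gamma> *\<^sub>R g))\<^sup>2 + \<gamma>\<^sup>2 * (\<sigma> * \<phi>))
          \<le> (1 - m * \<gamma>) * lyapunov a b \<phi> g v"
proof -
  \<comment> \<open>\<open>c\<close> is the dissipation rate, \<open>C1\<close> bounds the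
    noise-free second-order terms by multiples of \<open>S\<close>, \<open>C2\<close> converts this
    to \<open>\<phi> + y\<close> and adds the noise, and \<open>C3\<close> bounds the Lyapunov
    function from above.\<close>
  define c where "c = min (2 * L) (2 * b * \<mu> - K)"
  define C1 where "C1 = a * \<mu> + b * (\<mu>\<^sup>2 + \<mu> + 1) + K * (\<mu>\<^sup>2 + 2) + a * K"
  define C2 where "C2 = C1 * (1 + 2 * K) + (a * K / 2 + K + b) * \<sigma>"
  define C3 where "C3 = a + b + (1 + 2 * K)"
  define m where "m = c / (2 * C3)"
  \<comment> \<open>The first two bounds keep \<gamma> and \<open>\<gamma> * \<mu>\<close> in the
    unit interval; the third makes the remainder at most half of the dissipation.\<close>
  define \<delta> where "\<delta> = min 1 (min (1 / \<mu>) (c / (2 * C2)))"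
  have "a > 0" using assms by simp
  have "c > 0" using assms by (simp add: c_def)
  have "C1 > 0" unfolding C1_def using pos \<open>a > 0\<close> \<open>b > 0\<close> by (intro add_pos_pos mult_pos_pos) auto
  then have "C2 > 0" unfolding C2_def
    using pos \<open>a > 0\<close> \<open>b > 0\<close> \<open>\<sigma> \<ge> 0\<close> by (intro add_pos_nonneg mult_pos_pos mult_nonneg_nonneg) auto
  have "C3 > 0" using pos \<open>a > 0\<close> \<open>b > 0\<close> by (simp add: C3_def)
  show thesis
  proof (rule that)
    show "m > 0" using \<open>c > 0\<close> \<open>C3 > 0\<close> by (simp add: m_def)
    show "\<delta> > 0" using \<open>c > 0\<close> \<open>C2 > 0\<close> pos by (simp add: \<delta>_def)
    fix \<gamma> \<phi> and g v :: 'a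
    assume \<gamma>: "0 < \<gamma>" "\<gamma> \<le> \<delta>" and \<phi>: "0 \<le> \<phi>" "2 * L * \<phi> \<le> (norm g)\<^sup>2" "(norm g)\<^sup>2 \<le> 2 * K * \<phi>"
    define x G y where "x = g \<bullet> v" and "G = (norm g)\<^sup>2" and "y = (norm v)\<^sup>2"
    define q where "q = a * K / 2 * \<gamma>\<^sup>2 + K * \<gamma> + b"
    define S where "S = G + y"
    have \<gamma>1: "\<gamma> \<le> 1" "\<gamma> * \<mu> \<le> 1" "2 * C2 * \<gamma> \<le> c"
      using \<gamma> pos \<open>C2 > 0\<close> by (auto simp: \<delta>_def field_simps)
    have \<gamma>2: "\<gamma>\<^sup>2 \<le> 1" "0 \<le> \<gamma> * \<mu>" using \<gamma> \<gamma>1 pos by (auto simp: power_le_one)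
    have "G \<ge> 0" "y \<ge> 0" by (auto simp: G_def y_def)
    then have S: "0 \<le> S" "y \<le> S" "G \<le> S" by (auto simp: S_def)
    have "0 \<le> (norm (g + v))\<^sup>2" "0 \<le> (norm (g - v))\<^sup>2" by auto
    then have x: "2 * \<bar>x\<bar> \<le> S"
      unfolding x_def S_def G_def y_def power2_norm_eq_inner
      by (auto simp: inner_add inner_diff inner_commute abs_if)
    have "G \<le> 2 * K * \<phi>" using \<phi> by (simp add: G_def)
    moreover have "0 \<le> K * y" using pos \<open>y \<ge> 0\<close> by simp
    ultimately have SC: "S \<le> (1 + 2 * K) * (\<phi> + y)"
      using \<phi>(1) by (simp add: S_def algebra_simps)
    \<comment> \<open>Applied below with the factors \<open>1 - \<gamma> * \<mu>\<close> and
      \<open>\<gamma> * (1 - \<gamma> * \<mu>)\<close>, which lie in the unit interval by the choice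
      of \<delta>.\<close>
    have cross: "- 2 * t * x \<le> S" if "0 \<le> t" "t \<le> 1" for t
    proof -
      have "- 2 * t * x \<le> t * (2 * \<bar>x\<bar>)" using mult_left_mono[OF abs_ge_minus_self[of x] that(1)] by simp
      also have "\<dots> \<le> 1 * S" using that x S by (intro mult_mono) auto
      finally show ?thesis by simp
    qed
    \<comment> \<open>Here and in the next four estimates, the five summands in the bracket after
      \<open>\<gamma>\<^sup>2\<close> in \<open>lyapunov_expansion\<close> are bounded one at a
      time.\<close>
    have "- a * (\<mu> * x + G) \<le> a * \<mu> * S"
    proof -
      have "- (\<mu> * x) \<le> \<mu> * S"
        using mult_left_mono[of "- x" S \<mu>] x S pos by auto
      then have "a * (- (\<mu> * x) - G) \<le> a * (\<mu> * S)"
        using \<open>G \<ge> 0\<close> \<open>a > 0\<close> by (intro mult_left_mono) auto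
      then show ?thesis by (simp add: algebra_simps)
    qed
    moreover have "b * (\<mu>\<^sup>2 * y + 2 * \<mu> * x + G) \<le> b * (\<mu>\<^sup>2 + \<mu> + 1) * S"
    proof -
      have "\<mu>\<^sup>2 * y \<le> \<mu>\<^sup>2 * S" using S by (intro mult_left_mono) auto
      moreover have "\<mu> * (2 * x) \<le> \<mu> * S" using x pos by (intro mult_left_mono) auto
      ultimately have "\<mu>\<^sup>2 * y + 2 * \<mu> * x + G \<le> (\<mu>\<^sup>2 + \<mu> + 1) * S"
        using S by (simp add: algebra_simps)
      then show ?thesis using \<open>b > 0\<close> by (simp add: mult.assoc)
    qed
    moreover have "K * (- 2 * \<mu> * y + \<gamma> * \<mu>\<^sup>2 * y - 2 * (1 - \<gamma> * \<mu>) * x + \<gamma> * G) \<le> K * (\<mu>\<^sup>2 + 2) * S"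
    proof -
      have "\<gamma> * (\<mu>\<^sup>2 * y) \<le> 1 * (\<mu>\<^sup>2 * S)"
        using \<gamma> \<gamma>1 S \<open>y \<ge> 0\<close> by (intro mult_mono) auto
      moreover have "- 2 * (1 - \<gamma> * \<mu>) * x \<le> S"
        using cross[of "1 - \<gamma> * \<mu>"] \<gamma>1 \<gamma>2 by simp
      moreover have "\<gamma> * G \<le> 1 * S" using \<gamma> \<gamma>1 S \<open>G \<ge> 0\<close> by (intro mult_mono) auto
      moreover have "0 \<le> \<mu> * y" using pos \<open>y \<ge> 0\<close> by simp
      ultimately have "- 2 * \<mu> * y + \<gamma> * \<mu>\<^sup>2 * y - 2 * (1 - \<gamma> * \<mu>) * x + \<gamma> * G \<le> (\<mu>\<^sup>2 + 2) * S"
        by (simp add: algebra_simps)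
      then show ?thesis using pos by (simp add: mult.assoc)
    qed
    moreover have "a * K / 2 * ((1 - \<gamma> * \<mu>)\<^sup>2 * y - 2 * \<gamma> * (1 - \<gamma> * \<mu>) * x + \<gamma>\<^sup>2 * G) \<le> a * K * S"
    proof -
      have "(1 - \<gamma> * \<mu>)\<^sup>2 * y \<le> 1 * y"
        using \<gamma>1 \<gamma>2 \<open>y \<ge> 0\<close> by (intro mult_right_mono power_le_one) auto
      moreover have "- 2 * (\<gamma> * (1 - \<gamma> * \<mu>)) * x \<le> S"
        using \<gamma> \<gamma>1 \<gamma>2 by (intro cross mult_le_one mult_nonneg_nonneg) auto
      moreover have "\<gamma>\<^sup>2 * G \<le> 1 * G" using \<gamma>2 \<open>G \<ge> 0\<close> by (intro mult_right_mono) auto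
      ultimately have "(1 - \<gamma> * \<mu>)\<^sup>2 * y - 2 * \<gamma> * (1 - \<gamma> * \<mu>) * x + \<gamma>\<^sup>2 * G \<le> 2 * S"
        by (simp add: S_def algebra_simps)
      from mult_left_mono[OF this, of "a * K / 2"] show ?thesis
        using \<open>a > 0\<close> pos by simp
    qed
    moreover have "q * (\<sigma> * \<phi>) \<le> (a * K / 2 + K + b) * \<sigma> * (\<phi> + y)"
    proof -
      have "q \<le> a * K / 2 + K + b"
        unfolding q_def using \<gamma>1 \<gamma>2 \<open>a > 0\<close> pos by (intro add_mono mult_left_le) auto
      then have "q * (\<sigma> * \<phi>) \<le> (a * K / 2 + K + b) * (\<sigma> * (\<phi> + y))"
        using \<phi> \<open>y \<ge> 0\<close> \<open>\<sigma> \<ge> 0\<close> \<open>a > 0\<close> \<open>b > 0\<close> pos by (intro mult_mono mult_left_mono) auto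
      then show ?thesis by (simp add: mult.assoc)
    qed
    ultimately have "- a * (\<mu> * x + G) + b * (\<mu>\<^sup>2 * y + 2 * \<mu> * x + G)
      + K * (- 2 * \<mu> * y + \<gamma> * \<mu>\<^sup>2 * y - 2 * (1 - \<gamma> * \<mu>) * x + \<gamma> * G)
      + a * K / 2 * ((1 - \<gamma> * \<mu>)\<^sup>2 * y - 2 * \<gamma> * (1 - \<gamma> * \<mu>) * x + \<gamma>\<^sup>2 * G)
      + q * (\<sigma> * \<phi>) \<le> C1 * S + (a * K / 2 + K + b) * \<sigma> * (\<phi> + y)" (is "?T \<le> _")
      by (simp add: C1_def distrib_right)
    also have "\<dots> \<le> C2 * (\<phi> + y)"
      using mult_left_mono[OF SC, of C1] \<open>C1 > 0\<close> by (simp add: C2_def algebra_simps)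
    finally have T: "?T \<le> C2 * (\<phi> + y)" .
    \<comment> \<open>The Polyak-Lojasiewicz inequality enters here: it turns the dissipation
      \<open>G\<close> of the gradient into dissipation of \<phi>.\<close>
    have G_lower: "c * (\<phi> + y) \<le> G + (2 * b * \<mu> - K) * y"
    proof -
      have "c * \<phi> \<le> 2 * L * \<phi>" "c * y \<le> (2 * b * \<mu> - K) * y"
        using \<phi>(1) \<open>y \<ge> 0\<close> by (auto simp: c_def intro!: mult_right_mono)
      then show ?thesis using \<phi>(2) by (simp add: G_def distrib_left)
    qed
    have upper: "lyapunov a b \<phi> g v \<le> C3 * (\<phi> + y)"
    proof -
      have "0 \<le> a * y" "0 \<le> b * \<phi>" using \<open>a > 0\<close> \<open>b > 0\<close> \<phi>(1) \<open>y \<ge> 0\<close> by auto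
      moreover have "x \<le> (1 + 2 * K) * (\<phi> + y)" using x SC S by linarith
      ultimately show ?thesis
        by (simp add: lyapunov_def C3_def x_def[symmetric] y_def[symmetric] distrib_left distrib_right)
    qed
    have "a * \<phi> + (a * \<gamma> + 1) * (g \<bullet> ((1 - \<gamma> * \<mu>) *\<^sub>R v - \<gamma> *\<^sub>R g))
        + q * ((norm ((1 - \<gamma> * \<mu>) *\<^sub>R v - \<gamma> *\<^sub>R g))\<^sup>2 + \<gamma>\<^sup>2 * (\<sigma> * \<phi>))
      = lyapunov a b \<phi> g v - \<gamma> * (G + (2 * b * \<mu> - K) * y) + \<gamma>\<^sup>2 * ?T"
      unfolding x_def G_def y_def by (rule lyapunov_expansion[OF refl a q_def])
    also have "\<dots> \<le> lyapunov a b \<phi> g v - \<gamma> * (c * (\<phi> + y)) + \<gamma>\<^sup>2 * (C2 * (\<phi> + y))"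
      using \<gamma> by (intro add_mono diff_mono mult_left_mono G_lower T) auto
    \<comment> \<open>Since \<open>2 * C2 * \<gamma> \<le> c\<close>, the quadratic remainder
      consumes at most half of the linear gain.\<close>
    also have "\<dots> \<le> lyapunov a b \<phi> g v - \<gamma> * (c / 2 * (\<phi> + y))"
    proof -
      have "(2 * C2 * \<gamma>) * (\<gamma> * (\<phi> + y)) \<le> c * (\<gamma> * (\<phi> + y))"
        using \<gamma> \<phi>(1) \<open>y \<ge> 0\<close> by (intro mult_right_mono \<gamma>1) auto
      moreover have "\<gamma>\<^sup>2 * (C2 * (\<phi> + y)) = (2 * C2 * \<gamma>) * (\<gamma> * (\<phi> + y)) / 2"
          "\<gamma> * (c / 2 * (\<phi> + y)) = c * (\<gamma> * (\<phi> + y)) / 2"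
          "\<gamma> * (c * (\<phi> + y)) = c * (\<gamma> * (\<phi> + y))"
        by (simp_all add: power2_eq_square)
      ultimately show ?thesis by linarith
    qed
    also have "\<dots> \<le> lyapunov a b \<phi> g v - \<gamma> * (m * lyapunov a b \<phi> g v)"
    proof -
      have "m * lyapunov a b \<phi> g v \<le> m * (C3 * (\<phi> + y))"
        using \<open>m > 0\<close> by (intro mult_left_mono upper) auto
      also have "\<dots> = c / 2 * (\<phi> + y)" using \<open>C3 > 0\<close> by (simp add: m_def field_simps)
      finally show ?thesis using \<gamma> by simp
    qed
    finally show "a * \<phi> + (a * \<gamma> + 1) * (g \<bullet> ((1 - \<gamma> * \<mu>) *\<^sub>R v - \<gamma> *\<^sub>R g))
        + (a * K / 2 * \<gamma>\<^sup>2 + K * \<gamma> + b)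
          * ((norm ((1 - \<gamma> * \<mu>) *\<^sub>R v - \<gamma> *\<^sub>R g))\<^sup>2 + \<gamma>\<^sup>2 * (\<sigma> * \<phi>))
        \<le> (1 - m * \<gamma>) * lyapunov a b \<phi> g v"
      by (simp add: q_def algebra_simps)
  qed
qed

section \<open>Integrability\<close>

text \<open>By Tonelli the sum of the functions has finite integral, hence is finite almost
  everywhere.\<close>

lemma AE_summable_of_summable_integrals:
  fixes u :: "nat \<Rightarrow> 'a \<Rightarrow> real"
  assumes int: "\<And>n. integrable M (u n)" and nonneg: "\<And>n x. 0 \<le> u n x"
    and le: "\<And>n. (\<integral>x. u n x \<partial>M) \<le> s n" and "summable s"
  shows "AE x in M. summable (\<lambda>n. u n x)"
proof -
  have [measurable]: "u n \<in> borel_measurable M" for n using int by auto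
  have s: "0 \<le> s n" for n
    using le[of n] Bochner_Integration.integral_nonneg[of M "u n"] nonneg by (meson order_trans)
  have "(\<integral>\<^sup>+x. (\<Sum>n. ennreal (u n x)) \<partial>M) = (\<Sum>n. \<integral>\<^sup>+x. ennreal (u n x) \<partial>M)"
    by (rule nn_integral_suminf) simp
  also have "\<dots> \<le> (\<Sum>n. ennreal (s n))"
    using nonneg by (intro suminf_le) (auto simp: nn_integral_eq_integral[OF int] le ennreal_leI)
  also have "\<dots> = ennreal (\<Sum>n. s n)"
    by (rule suminf_ennreal2[OF s \<open>summable s\<close>])
  also have "\<dots> < \<infinity>" by simp
  finally have "AE x in M. (\<Sum>n. ennreal (u n x)) \<noteq> \<infinity>"
    by (intro nn_integral_PInf_AE) auto
  then show ?thesis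
    by eventually_elim (use nonneg in \<open>auto intro: summable_suminf_not_top\<close>)
qed

lemma norm_add_square_le:
  fixes x y :: "'a::real_inner"
  shows "(norm (x + y))\<^sup>2 \<le> 2 * (norm x)\<^sup>2 + 2 * (norm y)\<^sup>2"
proof -
  have "0 \<le> (norm (x - y))\<^sup>2" by simp
  then show ?thesis
    unfolding power2_norm_eq_inner by (simp add: inner_add inner_diff inner_commute)
qed

lemma mult_le_sum_squares:
  fixes x y :: real
  assumes "0 \<le> x" "0 \<le> y"
  shows "x * y \<le> x\<^sup>2 + y\<^sup>2"
  using sum_squares_bound[of x y] mult_nonneg_nonneg[OF assms] by linarith

lemma abs_inner_le_squares:
  fixes x y :: "'a::real_inner"
  shows "\<bar>x \<bullet> y\<bar> \<le> (norm x)\<^sup>2 + (norm y)\<^sup>2"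
proof -
  have "\<bar>x \<bullet> y\<bar> \<le> norm x * norm y" by (rule Cauchy_Schwarz_ineq2)
  also have "\<dots> \<le> (norm x)\<^sup>2 + (norm y)\<^sup>2"
    by (rule mult_le_sum_squares) auto
  finally show ?thesis .
qed

lemma L2_add:
  assumes "L2_random_vector M M Y" "L2_random_vector M M Z"
  shows "L2_random_vector M M (\<lambda>\<omega>. Y \<omega> + Z \<omega>)"
proof -
  have [measurable]: "Y \<in> borel_measurable M" "Z \<in> borel_measurable M"
    using assms by (auto simp: L2_random_vector_def)
  have "integrable M (\<lambda>\<omega>. 2 * (norm (Y \<omega>))\<^sup>2 + 2 * (norm (Z \<omega>))\<^sup>2)"
    using assms by (simp add: L2_random_vector_def)
  then have "integrable M (\<lambda>\<omega>. (norm (Y \<omega> + Z \<omega>))\<^sup>2)"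
    by (rule Bochner_Integration.integrable_bound) (use norm_add_square_le in auto)
  then show ?thesis by (simp add: L2_random_vector_def)
qed

lemma L2_scaleR:
  assumes "L2_random_vector M M Y"
  shows "L2_random_vector M M (\<lambda>\<omega>. c *\<^sub>R Y \<omega>)"
  using assms by (auto simp: L2_random_vector_def power_mult_distrib)

lemma L2_diff:
  assumes "L2_random_vector M M Y" "L2_random_vector M M Z"
  shows "L2_random_vector M M (\<lambda>\<omega>. Y \<omega> - Z \<omega>)"
  using L2_add[OF assms(1) L2_scaleR[OF assms(2), of "-1"]] by simp

lemma L2_indicator:
  assumes "L2_random_vector M M Y" "A \<in> sets M"
  shows "L2_random_vector M M (\<lambda>\<omega>. indicator A \<omega> *\<^sub>R Y \<omega>)"
proof -
  have "(\<lambda>\<omega>. (norm (indicator A \<omega> *\<^sub>R Y \<omega>))\<^sup>2) = (\<lambda>\<omega>. indicator A \<omega> *\<^sub>R (norm (Y \<omega>))\<^sup>2)"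
    by (auto simp: indicator_def)
  then show ?thesis
    using assms integrable_mult_indicator[OF assms(2), of "\<lambda>\<omega>. (norm (Y \<omega>))\<^sup>2"]
    by (auto simp: L2_random_vector_def)
qed

lemma L2_inner_integrable:
  assumes "L2_random_vector M M Y" "L2_random_vector M M Z"
  shows "integrable M (\<lambda>\<omega>. Y \<omega> \<bullet> Z \<omega>)"
proof -
  have [measurable]: "Y \<in> borel_measurable M" "Z \<in> borel_measurable M"
    using assms by (auto simp: L2_random_vector_def)
  have "integrable M (\<lambda>\<omega>. (norm (Y \<omega>))\<^sup>2 + (norm (Z \<omega>))\<^sup>2)"
    using assms by (simp add: L2_random_vector_def)
  then show ?thesis
    by (rule Bochner_Integration.integrable_bound) (use abs_inner_le_squares in auto)
qed

lemma L2_cong_AE: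
  assumes "L2_random_vector M M Z" "Y \<in> borel_measurable M" "AE \<omega> in M. Y \<omega> = Z \<omega>"
  shows "L2_random_vector M M Y"
proof -
  have "Z \<in> borel_measurable M" using assms by (simp add: L2_random_vector_def)
  then have "integrable M (\<lambda>\<omega>. (norm (Y \<omega>))\<^sup>2) = integrable M (\<lambda>\<omega>. (norm (Z \<omega>))\<^sup>2)"
    using assms(2,3) by (intro integrable_cong_AE) auto
  then show ?thesis using assms by (simp add: L2_random_vector_def)
qed

lemma L2_subalgebra:
  assumes "L2_random_vector M G Y" "subalgebra M G"
  shows "L2_random_vector M M Y"
  using assms measurable_from_subalg[of M G] by (auto simp: L2_random_vector_def)

text \<open>A Lipschitz map grows at most linearly; finiteness of the measure takes care of the
  constant \<open>g 0\<close>.\<close>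

lemma (in finite_measure) L2_lipschitz:
  fixes g :: "real ^ 'd \<Rightarrow> real ^ 'd"
  assumes lip: "K-lipschitz_on UNIV g" and "L2_random_vector M M Y"
  shows "L2_random_vector M M (\<lambda>\<omega>. g (Y \<omega>))"
proof -
  have [measurable]: "Y \<in> borel_measurable M"
    using assms by (auto simp: L2_random_vector_def)
  have [measurable]: "g \<in> borel_measurable borel"
    using lipschitz_on_continuous_on[OF lip] by (rule borel_measurable_continuous_onI)
  have bound: "(norm (g x))\<^sup>2 \<le> 2 * (norm (g 0))\<^sup>2 + 2 * (K\<^sup>2 * (norm x)\<^sup>2)" for x
  proof -
    have "norm (g x - g 0) \<le> K * norm x"
      using lipschitz_onD[OF lip, of x 0] by (simp add: dist_norm)
    then have "(norm (g x - g 0))\<^sup>2 \<le> K\<^sup>2 * (norm x)\<^sup>2"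
      by (simp add: power_mono power_mult_distrib[symmetric])
    then show ?thesis using norm_add_square_le[of "g 0" "g x - g 0"] by simp
  qed
  have "integrable M (\<lambda>\<omega>. 2 * (norm (g 0))\<^sup>2 + 2 * (K\<^sup>2 * (norm (Y \<omega>))\<^sup>2))"
    using assms by (simp add: L2_random_vector_def)
  then have "integrable M (\<lambda>\<omega>. (norm (g (Y \<omega>)))\<^sup>2)"
    by (rule Bochner_Integration.integrable_bound)
       (use bound in \<open>auto intro: order_trans[OF _ abs_ge_self]\<close>)
  then show ?thesis by (simp add: L2_random_vector_def)
qed

section \<open>Exponential sums over the step sizes\<close>

lemma time_Suc: "time \<gamma> (Suc n) = time \<gamma> n + \<gamma> (Suc n)"
  by (simp add: time_def)

text \<open>
  The sum is a lower Riemann sum for \<open>exp (- c s)\<close>, so it converges whether or not the total time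
  is finite.
\<close>

lemma summable_step_exp_time:
  assumes pos: "\<And>n. n \<ge> 1 \<Longrightarrow> \<gamma> n > 0" and "c > 0"
  shows "summable (\<lambda>n. \<gamma> (Suc n) * exp (- c * time \<gamma> (Suc n)))"
proof (rule summableI_nonneg_bounded)
  define e where "e n = exp (- c * time \<gamma> n)" for n
  \<comment> \<open>The inequality \<open>1 + s \<le> exp s\<close> bounds each term by a difference
    of consecutive values of \<open>e\<close>, so the sum telescopes to at most
    \<open>e 0 = 1\<close>.\<close>
  have step: "c * (\<gamma> (Suc n) * e (Suc n)) \<le> e n - e (Suc n)" for n
  proof -
    have "c * \<gamma> (Suc n) \<le> exp (c * \<gamma> (Suc n)) - 1"
      using exp_ge_add_one_self[of "c * \<gamma> (Suc n)"] by linarith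
    then have "c * \<gamma> (Suc n) * e (Suc n) \<le> (exp (c * \<gamma> (Suc n)) - 1) * e (Suc n)"
      by (rule mult_right_mono) (simp add: e_def)
    also have "exp (c * \<gamma> (Suc n)) * e (Suc n) = e n"
      by (simp add: e_def time_Suc exp_add[symmetric] algebra_simps)
    then have "(exp (c * \<gamma> (Suc n)) - 1) * e (Suc n) = e n - e (Suc n)"
      by (simp add: left_diff_distrib)
    finally show ?thesis by (simp add: mult.assoc)
  qed
  have sum_le: "c * (\<Sum>i<n. \<gamma> (Suc i) * e (Suc i)) \<le> 1" for n
  proof -
    have "c * (\<Sum>i<n. \<gamma> (Suc i) * e (Suc i)) \<le> (\<Sum>i<n. e i - e (Suc i))"
      unfolding sum_distrib_left by (intro sum_mono step)
    also have "\<dots> = e 0 - e n" by (rule sum_lessThan_telescope')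
    also have "\<dots> \<le> 1" by (simp add: e_def time_def)
    finally show ?thesis .
  qed
  show "0 \<le> \<gamma> (Suc n) * exp (- c * time \<gamma> (Suc n))" for n
    using pos[of "Suc n"] by simp
  show "(\<Sum>i<n. \<gamma> (Suc i) * exp (- c * time \<gamma> (Suc i))) \<le> 1 / c" for n
    using sum_le[of n] \<open>c > 0\<close> by (simp add: e_def field_simps)
qed

section \<open>Lyapunov decay along the process\<close>

context filtered_prob_space
begin

lemma sigma_finite_subalgebra_filtration: "sigma_finite_subalgebra M (F n)"
proof -
  interpret finite_measure_subalgebra M "F n"
    by unfold_locales (rule subalg)
  show ?thesis by unfold_locales
qed

lemma measurable_filtration: "Y \<in> borel_measurable (F n) \<Longrightarrow> Y \<in> borel_measurable M"
  using measurable_from_subalg[OF subalg] .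

lemma sets_filtration: "A \<in> sets (F n) \<Longrightarrow> A \<in> sets M"
  using subalg[of n] by (auto simp: subalgebra_def)

text \<open>This is what allows the indicator of the event to be moved inside conditional
  expectations given \<open>F n\<close>.\<close>

lemma stays_in_sets:
  assumes "\<And>n. X n \<in> borel_measurable (F n)" "open \<D>"
  shows "stays_in M \<D> X n \<in> sets (F n)"
proof -
  have "{\<omega> \<in> space (F n). X i \<omega> \<in> \<D>} \<in> sets (F n)" if "i \<le> n" for i
  proof -
    have "X i -` \<D> \<inter> space (F i) \<in> sets (F i)"
      by (rule measurable_sets[OF assms(1) borel_open[OF \<open>open \<D>\<close>]])
    moreover have "X i -` \<D> \<inter> space (F i) = {\<omega> \<in> space (F n). X i \<omega> \<in> \<D>}"
      by (auto simp: space_F)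
    ultimately show ?thesis using sets_F_mono[OF that] by auto
  qed
  then have A: "{\<omega> \<in> space (F n). \<forall>i\<in>{..n}. X i \<omega> \<in> \<D>} \<in> sets (F n)"
    by (intro sets.sets_Collect_finite_All) simp_all
  have "{\<omega> \<in> space (F n). \<forall>i\<in>{..n}. X i \<omega> \<in> \<D>} = stays_in M \<D> X n"
    by (auto simp: stays_in_def space_F)
  with A show ?thesis by metis
qed

text \<open>\<open>H\<close> is known at time \<open>n\<close>, so it can be moved inside the
  conditional expectation, where the increment averages to 0. As \<open>vec_cond_exp\<close> is
  defined by coordinates, the argument runs coordinatewise and is summed at the end.\<close>

lemma martingale_difference_orthogonal:
  fixes D :: "nat \<Rightarrow> 'w \<Rightarrow> real ^ 'd"
  assumes "L2_martingale_differences M F D" "L2_random_vector M M H" "H \<in> borel_measurable (F n)"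
  shows "(\<integral>\<omega>. H \<omega> \<bullet> D (Suc n) \<omega> \<partial>M) = 0"
proof -
  have D: "L2_random_vector M M (D (Suc n))"
    using assms(1) by (intro L2_subalgebra[OF _ subalg[of "Suc n"]]) (auto simp: L2_martingale_differences_def)
  interpret sigma_finite_subalgebra M "F n" by (rule sigma_finite_subalgebra_filtration)
  have [measurable]: "D (Suc n) \<in> borel_measurable M" "H \<in> borel_measurable M" "H \<in> borel_measurable (F n)"
    using assms D by (auto simp: L2_random_vector_def)
  have [measurable]: "(\<lambda>\<omega>. Y \<omega> $ i) \<in> borel_measurable N"
    if "Y \<in> borel_measurable N" for Y :: "'w \<Rightarrow> real ^ 'd" and N i
    using measurable_compose[OF that borel_measurable_continuous_onI[OF continuous_on_component[OF continuous_on_id]]]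
    by simp
  \<comment> \<open>Splitting the inner product into coordinates requires each product to be
    integrable on its own.\<close>
  have int: "integrable M (\<lambda>\<omega>. H \<omega> $ i * D (Suc n) \<omega> $ i)" for i
  proof (rule Bochner_Integration.integrable_bound)
    show "integrable M (\<lambda>\<omega>. (norm (H \<omega>))\<^sup>2 + (norm (D (Suc n) \<omega>))\<^sup>2)"
      using assms(2) D by (simp add: L2_random_vector_def)
    show "(\<lambda>\<omega>. H \<omega> $ i * D (Suc n) \<omega> $ i) \<in> borel_measurable M" by simp
    have "\<bar>x $ i * y $ i\<bar> \<le> (norm x)\<^sup>2 + (norm y)\<^sup>2" for x y :: "real ^ 'd"
    proof -
      have "\<bar>x $ i * y $ i\<bar> \<le> norm x * norm y"
        unfolding abs_mult by (intro mult_mono component_le_norm_cart) auto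
      also have "\<dots> \<le> (norm x)\<^sup>2 + (norm y)\<^sup>2"
        by (rule mult_le_sum_squares) auto
      finally show ?thesis .
    qed
    then show "AE \<omega> in M. norm (H \<omega> $ i * D (Suc n) \<omega> $ i) \<le> norm ((norm (H \<omega>))\<^sup>2 + (norm (D (Suc n) \<omega>))\<^sup>2)"
      by auto
  qed
  have "(\<integral>\<omega>. H \<omega> $ i * D (Suc n) \<omega> $ i \<partial>M) = 0" for i
  proof -
    have "(\<integral>\<omega>. H \<omega> $ i * D (Suc n) \<omega> $ i \<partial>M)
        = (\<integral>\<omega>. H \<omega> $ i * real_cond_exp M (F n) (\<lambda>\<omega>'. D (Suc n) \<omega>' $ i) \<omega> \<partial>M)"
      by (rule real_cond_exp_intg(2)[symmetric, OF int]) measurable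
    also have "\<dots> = (\<integral>\<omega>. 0 \<partial>M)"
    proof (rule integral_cong_AE)
      have "AE \<omega> in M. vec_cond_exp M (F n) (D (Suc n)) \<omega> = 0"
        using assms(1) by (simp add: L2_martingale_differences_def)
      then show "AE \<omega> in M. H \<omega> $ i * real_cond_exp M (F n) (\<lambda>\<omega>'. D (Suc n) \<omega>' $ i) \<omega> = 0"
        by eventually_elim (auto simp: vec_cond_exp_def vec_eq_iff)
    qed measurable
    finally show ?thesis by simp
  qed
  then show ?thesis using int by (simp add: inner_vec_def)
qed

end

text \<open>The constants are fixed here, and all that is used of the Polyak-Lojasiewicz inequality
  and of the small step sizes is packed into \<open>drift\<close>. What follows is then purely
  probabilistic; the final theorem verifies these assumptions.\<close>

locale msgd_lyapunov = msgd M F grad \<mu> \<gamma> D X V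
  for M :: "'w measure" and F :: "nat \<Rightarrow> 'w measure" and grad :: "real ^ 'd \<Rightarrow> real ^ 'd"
    and \<mu> :: real and \<gamma> :: "nat \<Rightarrow> real" and D X V :: "nat \<Rightarrow> 'w \<Rightarrow> real ^ 'd" +
  fixes f :: "real ^ 'd \<Rightarrow> real" and \<D> :: "(real ^ 'd) set" and K \<sigma> a b m :: real
  assumes gderiv: "\<And>x. GDERIV f x :> grad x"
    and lipschitz: "K-lipschitz_on UNIV grad"
    and f_nonneg: "\<And>x. f x \<ge> 0"
    and open_domain: "open \<D>"
    and noise_bound: "\<And>n. AE \<omega> in M. \<omega> \<in> stays_in M \<D> X n \<longrightarrow>
       real_cond_exp M (F n) (\<lambda>\<omega>'. (norm (D (Suc n) \<omega>'))\<^sup>2) \<omega> \<le> \<sigma> * f (X n \<omega>)"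
    and pos: "K > 0" "a > 0" "b > 0" "m > 0"
    and lower: "\<And>x v. a / 2 * f x + b / 2 * (norm v)\<^sup>2 \<le> lyapunov a b (f x) (grad x) v"
    and drift: "\<And>n x v. x \<in> \<D> \<Longrightarrow>
      a * f x + (a * \<gamma> (Suc n) + 1) * (grad x \<bullet> ((1 - \<gamma> (Suc n) * \<mu>) *\<^sub>R v - \<gamma> (Suc n) *\<^sub>R grad x))
        + (a * K / 2 * (\<gamma> (Suc n))\<^sup>2 + K * \<gamma> (Suc n) + b)
          * ((norm ((1 - \<gamma> (Suc n) * \<mu>) *\<^sub>R v - \<gamma> (Suc n) *\<^sub>R grad x))\<^sup>2 + (\<gamma> (Suc n))\<^sup>2 * (\<sigma> * f x))
      \<le> (1 - m * \<gamma> (Suc n)) * lyapunov a b (f x) (grad x) v"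
begin

abbreviation "A \<equiv> stays_in M \<D> X"
abbreviation "\<Phi> n \<omega> \<equiv> lyapunov a b (f (X n \<omega>)) (grad (X n \<omega>)) (V n \<omega>)"

lemma lyapunov_nonneg: "0 \<le> lyapunov a b (f x) (grad x) v"
proof -
  have "0 \<le> a / 2 * f x + b / 2 * (norm v)\<^sup>2" using pos f_nonneg by simp
  then show ?thesis using lower[of x v] by linarith
qed

text \<open>The position moves with the updated velocity \<open>v'\<close>, so the squared norm of
  \<open>v'\<close> arises three times: from the descent lemma, from the change of the gradient and
  from the kinetic term. Their coefficients add up to \<open>q\<close>. Expanding
  \<open>v' = w + t *\<^sub>R d\<close> then separates the parts linear and quadratic in the
  noise.\<close>

lemma lyapunov_one_step:
  assumes "t > 0" and w: "w = (1 - t * \<mu>) *\<^sub>R v - t *\<^sub>R grad x"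
    and q: "q = a * K / 2 * t\<^sup>2 + K * t + b"
    and v': "v' = w + t *\<^sub>R d" and x': "x' = x + t *\<^sub>R v'"
  shows "lyapunov a b (f x') (grad x') v' \<le>
    a * f x + (a * t + 1) * (grad x \<bullet> w) + q * (norm w)\<^sup>2
      + t * (((a * t + 1) *\<^sub>R grad x + (2 * q) *\<^sub>R w) \<bullet> d) + q * t\<^sup>2 * (norm d)\<^sup>2"
proof -
  have "f x' \<le> f x + grad x \<bullet> (x' - x) + K / 2 * (norm (x' - x))\<^sup>2"
    by (rule gderiv_lipschitz_descent[OF gderiv lipschitz])
  then have "a * f x' \<le> a * (f x + t * (grad x \<bullet> v') + K / 2 * t\<^sup>2 * (norm v')\<^sup>2)"
    using pos by (intro mult_left_mono) (auto simp: x' power_mult_distrib)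
  moreover have "grad x' \<bullet> v' \<le> grad x \<bullet> v' + K * t * (norm v')\<^sup>2"
  proof -
    have "norm (grad x' - grad x) \<le> K * (t * norm v')"
      using lipschitz_onD[OF lipschitz, of x' x] \<open>t > 0\<close> by (simp add: dist_norm x')
    then have "norm (grad x' - grad x) * norm v' \<le> K * (t * norm v') * norm v'"
      by (intro mult_right_mono) auto
    then show ?thesis
      using norm_cauchy_schwarz[of "grad x' - grad x" v']
      by (simp add: inner_diff_left power2_eq_square mult.assoc)
  qed
  ultimately have "lyapunov a b (f x') (grad x') v' \<le> a * f x + (a * t + 1) * (grad x \<bullet> v') + q * (norm v')\<^sup>2"
    by (simp add: lyapunov_def q algebra_simps)
  also have "(norm v')\<^sup>2 = (norm w)\<^sup>2 + 2 * t * (w \<bullet> d) + t\<^sup>2 * (norm d)\<^sup>2"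
    unfolding v' power2_norm_eq_inner by (simp add: inner_add inner_commute power2_eq_square algebra_simps)
  also have "grad x \<bullet> v' = grad x \<bullet> w + t * (grad x \<bullet> d)"
    by (simp add: v' inner_add)
  finally show ?thesis by (simp add: inner_add algebra_simps)
qed

lemma A_sets: "A n \<in> sets (F n)"
  by (rule stays_in_sets[OF X_adapted open_domain])

lemma A_sets_M [measurable]: "A n \<in> sets M"
  by (rule sets_filtration[OF A_sets])

lemma A_Suc_subset: "A (Suc n) \<subseteq> A n"
  by (auto simp: stays_in_def)

lemma borel_measurable_grad: "grad \<in> borel_measurable borel"
  using lipschitz_on_continuous_on[OF lipschitz] by (rule borel_measurable_continuous_onI)

lemma borel_measurable_f: "f \<in> borel_measurable borel"
proof (intro borel_measurable_continuous_onI continuous_at_imp_continuous_on ballI)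
  show "isCont f x" for x
    using gderiv[of x] unfolding gderiv_def by (rule has_derivative_continuous)
qed

section \<open>Square integrability along the process\<close>

lemma L2_D: "L2_random_vector M M (D (Suc n))"
  using noise by (intro L2_subalgebra[OF _ subalg[of "Suc n"]]) (auto simp: L2_martingale_differences_def)

text \<open>The induction is joint because each update uses both processes. The recursions hold only
  almost surely, so measurability is taken from adaptedness.\<close>

lemma L2_XV: "L2_random_vector M M (X n) \<and> L2_random_vector M M (V n)"
proof (induction n)
  case 0
  show ?case using L2_subalgebra[OF X_init subalg] L2_subalgebra[OF V_init subalg] ..
next
  case (Suc n)
  have "L2_random_vector M M (V (Suc n))"
  proof (rule L2_cong_AE[OF _ measurable_filtration[OF V_adapted] V_step])
    show "L2_random_vector M M (\<lambda>\<omega>. V n \<omega> - (\<gamma> (Suc n) * \<mu>) *\<^sub>R V n \<omega> - \<gamma> (Suc n) *\<^sub>R grad (X n \<omega>)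
            + \<gamma> (Suc n) *\<^sub>R D (Suc n) \<omega>)"
      using Suc by (intro L2_add L2_diff L2_scaleR L2_lipschitz[OF lipschitz] L2_D) auto
  qed
  moreover have "L2_random_vector M M (X (Suc n))"
  proof (rule L2_cong_AE[OF _ measurable_filtration[OF X_adapted] X_step])
    show "L2_random_vector M M (\<lambda>\<omega>. X n \<omega> + \<gamma> (Suc n) *\<^sub>R V (Suc n) \<omega>)"
      using Suc calculation by (intro L2_add L2_scaleR) auto
  qed
  ultimately show ?case by simp
qed

lemmas L2_X = L2_XV[THEN conjunct1] and L2_V = L2_XV[THEN conjunct2]

lemma L2_grad: "L2_random_vector M M (\<lambda>\<omega>. grad (X n \<omega>))"
  by (rule L2_lipschitz[OF lipschitz L2_X])

lemma L2_norm_integrable: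
  "L2_random_vector M M Y \<Longrightarrow> integrable M (\<lambda>\<omega>. (norm (Y \<omega>))\<^sup>2)"
  by (simp add: L2_random_vector_def)

lemma measurable_XVD [measurable]:
  "X n \<in> borel_measurable M" "V n \<in> borel_measurable M" "D (Suc n) \<in> borel_measurable M"
  using L2_X L2_V L2_D by (auto simp: L2_random_vector_def)

text \<open>The descent lemma based at 0 bounds \<open>f\<close> by a quadratic function, so square
  integrability of \<open>X n\<close> suffices.\<close>

lemma integrable_f: "integrable M (\<lambda>\<omega>. f (X n \<omega>))"
proof (rule Bochner_Integration.integrable_bound)
  show "integrable M (\<lambda>\<omega>. f 0 + ((norm (grad 0))\<^sup>2 + (norm (X n \<omega>))\<^sup>2) + K / 2 * (norm (X n \<omega>))\<^sup>2)"
    using L2_norm_integrable[OF L2_X[of n]] by simp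
  show "(\<lambda>\<omega>. f (X n \<omega>)) \<in> borel_measurable M"
    using measurable_compose[OF measurable_XVD(1) borel_measurable_f] .
  have "f x \<le> f 0 + ((norm (grad 0))\<^sup>2 + (norm x)\<^sup>2) + K / 2 * (norm x)\<^sup>2" for x
    using gderiv_lipschitz_descent[OF gderiv lipschitz, of x 0] abs_inner_le_squares[of "grad 0" x]
    by simp
  then show "AE \<omega> in M. norm (f (X n \<omega>))
      \<le> norm (f 0 + ((norm (grad 0))\<^sup>2 + (norm (X n \<omega>))\<^sup>2) + K / 2 * (norm (X n \<omega>))\<^sup>2)"
    using f_nonneg by (auto intro: order_trans[OF _ abs_ge_self])
qed

lemma integrable_indicator_mult:
  fixes u :: "'w \<Rightarrow> real"
  shows "integrable M u \<Longrightarrow> integrable M (\<lambda>\<omega>. indicator (A n) \<omega> * u \<omega>)"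
  using integrable_mult_indicator[OF A_sets_M, of u n] by simp

lemma integrable_\<Phi>: "integrable M (\<Phi> n)"
  unfolding lyapunov_def
  using integrable_f[of n] L2_inner_integrable[OF L2_grad L2_V, of n n] L2_norm_integrable[OF L2_V, of n]
  by simp

section \<open>Contraction in expectation\<close>

lemma noise_second_moment:
  "(\<integral>\<omega>. indicator (A n) \<omega> * (norm (D (Suc n) \<omega>))\<^sup>2 \<partial>M) \<le> (\<integral>\<omega>. indicator (A n) \<omega> * (\<sigma> * f (X n \<omega>)) \<partial>M)"
proof -
  interpret sigma_finite_subalgebra M "F n" by (rule sigma_finite_subalgebra_filtration)
  note int = integrable_indicator_mult[OF L2_norm_integrable[OF L2_D], of n n]
  have meas: "(indicator (A n) :: 'w \<Rightarrow> real) \<in> borel_measurable (F n)"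
    using A_sets by simp
  have "(\<integral>\<omega>. indicator (A n) \<omega> * (norm (D (Suc n) \<omega>))\<^sup>2 \<partial>M)
      = (\<integral>\<omega>. indicator (A n) \<omega> * real_cond_exp M (F n) (\<lambda>\<omega>'. (norm (D (Suc n) \<omega>'))\<^sup>2) \<omega> \<partial>M)"
    by (rule real_cond_exp_intg(2)[symmetric, OF int meas]) measurable
  \<comment> \<open>The conditional bound is assumed on \<open>A n\<close> alone; off this event
    both integrands are 0.\<close>
  also have "\<dots> \<le> (\<integral>\<omega>. indicator (A n) \<omega> * (\<sigma> * f (X n \<omega>)) \<partial>M)"
  proof (rule integral_mono_AE)
    show "integrable M (\<lambda>\<omega>. indicator (A n) \<omega> * real_cond_exp M (F n) (\<lambda>\<omega>'. (norm (D (Suc n) \<omega>'))\<^sup>2) \<omega>)"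
      by (rule real_cond_exp_intg(1)[OF int meas]) measurable
    show "integrable M (\<lambda>\<omega>. indicator (A n) \<omega> * (\<sigma> * f (X n \<omega>)))"
      by (intro integrable_indicator_mult integrable_mult_right integrable_f)
    show "AE \<omega> in M. indicator (A n) \<omega> * real_cond_exp M (F n) (\<lambda>\<omega>'. (norm (D (Suc n) \<omega>'))\<^sup>2) \<omega>
        \<le> indicator (A n) \<omega> * (\<sigma> * f (X n \<omega>))"
      using noise_bound[of n] by eventually_elim (auto simp: indicator_def)
  qed
  finally show ?thesis .
qed

text \<open>\<open>lyapunov_one_step\<close> is integrated over \<open>A n\<close>, an event decided
  at time \<open>n\<close>. The term linear in the noise has mean 0, the quadratic one is controlled
  by \<open>noise_second_moment\<close>, and the rest contracts by \<open>drift\<close>, which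
  applies because \<open>X n\<close> lies in \<open>\<D>\<close> on this event.\<close>

lemma expected_drift:
  "(\<integral>\<omega>. indicator (A n) \<omega> * \<Phi> (Suc n) \<omega> \<partial>M)
    \<le> (1 - m * \<gamma> (Suc n)) * (\<integral>\<omega>. indicator (A n) \<omega> * \<Phi> n \<omega> \<partial>M)"
proof -
  define t where "t = \<gamma> (Suc n)"
  define q where "q = a * K / 2 * t\<^sup>2 + K * t + b"
  define W where "W \<omega> = (1 - t * \<mu>) *\<^sub>R V n \<omega> - t *\<^sub>R grad (X n \<omega>)" for \<omega>
  \<comment> \<open>The indicator is built into \<open>H\<close>, which makes it a square-integrable
    test vector known at time \<open>n\<close>, as orthogonality demands.\<close>
  define H where "H \<omega> = indicator (A n) \<omega> *\<^sub>R ((a * t + 1) *\<^sub>R grad (X n \<omega>) + (2 * q) *\<^sub>R W \<omega>)" for \<omega>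
  define R where "R \<omega> = a * f (X n \<omega>) + (a * t + 1) * (grad (X n \<omega>) \<bullet> W \<omega>) + q * (norm (W \<omega>))\<^sup>2" for \<omega>
  have "t > 0" using step_pos by (simp add: t_def)
  have "q > 0" using \<open>t > 0\<close> pos by (auto simp: q_def intro!: add_nonneg_pos)
  have L2_W: "L2_random_vector M M W"
    unfolding W_def by (intro L2_diff L2_scaleR L2_V L2_grad)
  have L2_H: "L2_random_vector M M H"
    unfolding H_def by (intro L2_indicator L2_add L2_scaleR L2_grad L2_W A_sets_M)
  have H_meas: "H \<in> borel_measurable (F n)"
  proof -
    note [measurable] = A_sets[of n] X_adapted[of n] V_adapted[of n] borel_measurable_grad
    show ?thesis unfolding H_def W_def by measurable
  qed
  have int_R: "integrable M R"
    unfolding R_def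
    by (intro Bochner_Integration.integrable_add integrable_mult_right integrable_f
      L2_inner_integrable L2_grad L2_W L2_norm_integrable)
  note int_IR = integrable_indicator_mult[OF int_R, of n]
    and int_ID = integrable_indicator_mult[OF L2_norm_integrable[OF L2_D], of n n]
    and int_HD = L2_inner_integrable[OF L2_H L2_D, of n]
  have int_If: "integrable M (\<lambda>\<omega>. indicator (A n) \<omega> * (\<sigma> * f (X n \<omega>)))"
    by (intro integrable_indicator_mult integrable_mult_right integrable_f)
  have "(\<integral>\<omega>. indicator (A n) \<omega> * \<Phi> (Suc n) \<omega> \<partial>M)
      \<le> (\<integral>\<omega>. indicator (A n) \<omega> * R \<omega> + t * (H \<omega> \<bullet> D (Suc n) \<omega>)
            + (q * t\<^sup>2) * (indicator (A n) \<omega> * (norm (D (Suc n) \<omega>))\<^sup>2) \<partial>M)"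
  proof (rule integral_mono_AE)
    show "AE \<omega> in M. indicator (A n) \<omega> * \<Phi> (Suc n) \<omega> \<le> indicator (A n) \<omega> * R \<omega> + t * (H \<omega> \<bullet> D (Suc n) \<omega>)
            + (q * t\<^sup>2) * (indicator (A n) \<omega> * (norm (D (Suc n) \<omega>))\<^sup>2)"
      using X_step[of n] V_step[of n]
    proof eventually_elim
      case (elim \<omega>)
      have "V (Suc n) \<omega> = W \<omega> + t *\<^sub>R D (Suc n) \<omega>"
        using elim by (simp add: W_def t_def algebra_simps)
      moreover have "X (Suc n) \<omega> = X n \<omega> + t *\<^sub>R V (Suc n) \<omega>"
        using elim by (simp add: t_def)
      ultimately have "\<Phi> (Suc n) \<omega> \<le> R \<omega> + t * (((a * t + 1) *\<^sub>R grad (X n \<omega>) + (2 * q) *\<^sub>R W \<omega>) \<bullet> D (Suc n) \<omega>)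
          + q * t\<^sup>2 * (norm (D (Suc n) \<omega>))\<^sup>2"
        unfolding R_def using lyapunov_one_step[OF \<open>t > 0\<close> W_def q_def] by blast
      then show ?case
        by (cases "\<omega> \<in> A n") (auto simp: H_def)
    qed
  qed (intro Bochner_Integration.integrable_add integrable_mult_right int_IR int_ID int_HD
      integrable_indicator_mult integrable_\<Phi>)+
  also have "\<dots> = (\<integral>\<omega>. indicator (A n) \<omega> * R \<omega> \<partial>M) + t * (\<integral>\<omega>. H \<omega> \<bullet> D (Suc n) \<omega> \<partial>M)
      + (q * t\<^sup>2) * (\<integral>\<omega>. indicator (A n) \<omega> * (norm (D (Suc n) \<omega>))\<^sup>2 \<partial>M)"
    using int_IR int_ID int_HD by simp
  also have "\<dots> \<le> (\<integral>\<omega>. indicator (A n) \<omega> * R \<omega> \<partial>M)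
      + (q * t\<^sup>2) * (\<integral>\<omega>. indicator (A n) \<omega> * (\<sigma> * f (X n \<omega>)) \<partial>M)"
    unfolding martingale_difference_orthogonal[OF noise L2_H H_meas]
    using \<open>q > 0\<close> mult_left_mono[OF noise_second_moment[of n], of "q * t\<^sup>2"] by simp
  \<comment> \<open>The two integrals are merged again because \<open>drift\<close> is a pointwise
    bound on the sum, not on its parts.\<close>
  also have "\<dots> = (\<integral>\<omega>. indicator (A n) \<omega> * R \<omega> + (q * t\<^sup>2) * (indicator (A n) \<omega> * (\<sigma> * f (X n \<omega>))) \<partial>M)"
    using int_IR int_If by simp
  also have "\<dots> \<le> (\<integral>\<omega>. (1 - m * t) * (indicator (A n) \<omega> * \<Phi> n \<omega>) \<partial>M)"
  proof (rule integral_mono)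
    fix \<omega> assume "\<omega> \<in> space M"
    have "R \<omega> + q * t\<^sup>2 * (\<sigma> * f (X n \<omega>)) \<le> (1 - m * t) * \<Phi> n \<omega>" if "\<omega> \<in> A n"
    proof -
      have "X n \<omega> \<in> \<D>" using that by (auto simp: stays_in_def)
      from drift[OF this, of n "V n \<omega>"] show ?thesis
        by (simp add: R_def q_def W_def t_def distrib_left mult.assoc)
    qed
    then show "indicator (A n) \<omega> * R \<omega> + (q * t\<^sup>2) * (indicator (A n) \<omega> * (\<sigma> * f (X n \<omega>)))
        \<le> (1 - m * t) * (indicator (A n) \<omega> * \<Phi> n \<omega>)"
      by (cases "\<omega> \<in> A n") auto
  qed (intro Bochner_Integration.integrable_add integrable_mult_right int_IR int_If
      integrable_indicator_mult integrable_\<Phi>)+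
  finally show ?thesis by (simp add: t_def)
qed

section \<open>Exponential decay of expectations\<close>

definition "U = (\<integral>\<omega>. indicator (A 0) \<omega> * \<Phi> 0 \<omega> \<partial>M)"

lemma integral_indicator_\<Phi>_nonneg: "0 \<le> (\<integral>\<omega>. indicator (A n) \<omega> * \<Phi> k \<omega> \<partial>M)"
  by (intro integral_nonneg_AE AE_I2 mult_nonneg_nonneg lyapunov_nonneg) auto

lemma U_nonneg: "0 \<le> U"
  unfolding U_def by (rule integral_indicator_\<Phi>_nonneg)

text \<open>Iteration of \<open>expected_drift\<close> with \<open>1 - s \<le> exp (- s)\<close>,
  valid for every real \<open>s\<close>, so the contraction factor may have either sign.\<close>

lemma expected_decay:
  "(\<integral>\<omega>. indicator (A n) \<omega> * \<Phi> (Suc n) \<omega> \<partial>M) \<le> exp (- m * time \<gamma> (Suc n)) * U"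
proof -
  have step: "(\<integral>\<omega>. indicator (A n) \<omega> * \<Phi> (Suc n) \<omega> \<partial>M) \<le> exp (- m * time \<gamma> (Suc n)) * U"
    if "(\<integral>\<omega>. indicator (A n) \<omega> * \<Phi> n \<omega> \<partial>M) \<le> exp (- m * time \<gamma> n) * U" for n
  proof -
    have "(\<integral>\<omega>. indicator (A n) \<omega> * \<Phi> (Suc n) \<omega> \<partial>M)
        \<le> exp (- m * \<gamma> (Suc n)) * (\<integral>\<omega>. indicator (A n) \<omega> * \<Phi> n \<omega> \<partial>M)"
    proof (rule order_trans[OF expected_drift mult_right_mono[OF _ integral_indicator_\<Phi>_nonneg]])
      show "1 - m * \<gamma> (Suc n) \<le> exp (- m * \<gamma> (Suc n))"
        using exp_ge_add_one_self[of "- m * \<gamma> (Suc n)"] by linarith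
    qed
    also have "\<dots> \<le> exp (- m * \<gamma> (Suc n)) * (exp (- m * time \<gamma> n) * U)"
      using that by (intro mult_left_mono) auto
    also have "\<dots> = exp (- m * time \<gamma> (Suc n)) * U"
      by (simp add: time_Suc exp_add[symmetric] algebra_simps)
    finally show ?thesis .
  qed
  show ?thesis
  proof (induction n)
    case 0
    show ?case by (rule step) (simp add: time_def U_def)
  next
    case (Suc n)
    \<comment> \<open>The induction hypothesis concerns \<open>A n\<close>, the next step needs
      \<open>A (Suc n)\<close>; shrinking the event only lowers the integral of a nonnegative
      function.\<close>
    have "(\<integral>\<omega>. indicator (A (Suc n)) \<omega> * \<Phi> (Suc n) \<omega> \<partial>M) \<le> (\<integral>\<omega>. indicator (A n) \<omega> * \<Phi> (Suc n) \<omega> \<partial>M)"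
      using A_Suc_subset[of n]
      by (intro integral_mono integrable_indicator_mult integrable_\<Phi> mult_right_mono lyapunov_nonneg)
         (auto simp: indicator_def)
    with Suc show ?case by (intro step) linarith
  qed
qed

text \<open>Serves both halves of the lower bound \<open>lower\<close>: the objective with
  \<open>c = a / 2\<close> and the squared velocity with \<open>c = b / 2\<close>.\<close>

lemma expected_le_of_lyapunov:
  assumes int: "integrable M u" and "c > 0" and le: "\<And>\<omega>. c * u \<omega> \<le> \<Phi> (Suc n) \<omega>"
  shows "(\<integral>\<omega>. indicator (A n) \<omega> * u \<omega> \<partial>M) \<le> U / c * exp (- m * time \<gamma> (Suc n))"
proof -
  have "c * (\<integral>\<omega>. indicator (A n) \<omega> * u \<omega> \<partial>M) = (\<integral>\<omega>. indicator (A n) \<omega> * (c * u \<omega>) \<partial>M)"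
    by (simp add: mult.left_commute)
  also have "\<dots> \<le> (\<integral>\<omega>. indicator (A n) \<omega> * \<Phi> (Suc n) \<omega> \<partial>M)"
    by (intro integral_mono integrable_indicator_mult integrable_\<Phi> mult_left_mono le
        integrable_mult_right int) auto
  also note expected_decay
  finally show ?thesis using \<open>c > 0\<close> by (simp add: field_simps)
qed

lemma expected_f_decay:
  "(\<integral>\<omega>. indicator (A n) \<omega> * f (X (Suc n) \<omega>) \<partial>M) \<le> U / (a / 2) * exp (- m * time \<gamma> (Suc n))"
proof (rule expected_le_of_lyapunov[OF integrable_f])
  fix \<omega>
  have "0 \<le> b / 2 * (norm (V (Suc n) \<omega>))\<^sup>2" using pos by simp
  then show "a / 2 * f (X (Suc n) \<omega>) \<le> \<Phi> (Suc n) \<omega>"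
    using lower[of "X (Suc n) \<omega>" "V (Suc n) \<omega>"] by linarith
qed (use pos in simp)

lemma expected_V_decay:
  "(\<integral>\<omega>. indicator (A n) \<omega> * (norm (V (Suc n) \<omega>))\<^sup>2 \<partial>M) \<le> U / (b / 2) * exp (- m * time \<gamma> (Suc n))"
proof (rule expected_le_of_lyapunov[OF L2_norm_integrable[OF L2_V]])
  fix \<omega>
  have "0 \<le> a / 2 * f (X (Suc n) \<omega>)" using pos f_nonneg by simp
  then show "b / 2 * (norm (V (Suc n) \<omega>))\<^sup>2 \<le> \<Phi> (Suc n) \<omega>"
    using lower[of "X (Suc n) \<omega>" "V (Suc n) \<omega>"] by linarith
qed (use pos in simp)

section \<open>Almost sure statements\<close>

lemma f_decay_AE:
  assumes "summable (\<lambda>i. exp ((m' - m) * time \<gamma> i))"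
  shows "AE \<omega> in M. \<omega> \<in> (\<Inter>n. A n) \<longrightarrow> (\<lambda>n. exp (m' * time \<gamma> n) * f (X n \<omega>)) \<longlonglongrightarrow> 0"
proof -
  \<comment> \<open>The decay estimate pairs the event \<open>A n\<close> with time
    \<open>Suc n\<close>, hence the shifted series. On the intersection of all events the indicators
    are 1, the terms of the convergent series tend to 0, and \<open>LIMSEQ_imp_Suc\<close> undoes
    the shift.\<close>
  define u where "u n \<omega> = exp (m' * time \<gamma> (Suc n)) * (indicator (A n) \<omega> * f (X (Suc n) \<omega>))" for n \<omega>
  have "AE \<omega> in M. summable (\<lambda>n. u n \<omega>)"
  proof (rule AE_summable_of_summable_integrals)
    show "integrable M (u n)" for n
      unfolding u_def by (intro integrable_mult_right integrable_indicator_mult integrable_f)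
    show "0 \<le> u n \<omega>" for n \<omega> using f_nonneg by (simp add: u_def)
    show "(\<integral>\<omega>. u n \<omega> \<partial>M) \<le> U / (a / 2) * exp ((m' - m) * time \<gamma> (Suc n))" for n
    proof -
      have "(\<integral>\<omega>. u n \<omega> \<partial>M) \<le> exp (m' * time \<gamma> (Suc n)) * (U / (a / 2) * exp (- m * time \<gamma> (Suc n)))"
        unfolding u_def integral_mult_right_zero by (intro mult_left_mono expected_f_decay) auto
      also have "\<dots> = U / (a / 2) * exp ((m' - m) * time \<gamma> (Suc n))"
        by (simp add: left_diff_distrib exp_diff exp_minus field_simps)
      finally show ?thesis .
    qed
    show "summable (\<lambda>n. U / (a / 2) * exp ((m' - m) * time \<gamma> (Suc n)))"
      using assms by (intro summable_mult) (simp add: summable_Suc_iff[where f = "\<lambda>i. exp ((m' - m) * time \<gamma> i)"])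
  qed
  then show ?thesis
  proof eventually_elim
    case (elim \<omega>)
    show ?case
    proof
      assume "\<omega> \<in> (\<Inter>n. A n)"
      then have "(\<lambda>n. u n \<omega>) = (\<lambda>n. exp (m' * time \<gamma> (Suc n)) * f (X (Suc n) \<omega>))"
        by (auto simp: u_def)
      with summable_LIMSEQ_zero[OF elim]
      have "(\<lambda>n. exp (m' * time \<gamma> (Suc n)) * f (X (Suc n) \<omega>)) \<longlonglongrightarrow> 0" by simp
      then show "(\<lambda>n. exp (m' * time \<gamma> n) * f (X n \<omega>)) \<longlonglongrightarrow> 0"
        by (rule LIMSEQ_imp_Suc)
    qed
  qed
qed

text \<open>The second moment controls the first through \<open>r \<le> e + r\<^sup>2 / e\<close>,
  at the price of halving the rate.\<close>

lemma expected_norm_V_decay: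
  "integrable M (\<lambda>\<omega>. indicator (A n) \<omega> * norm (V (Suc n) \<omega>))" (is ?int)
  "(\<integral>\<omega>. indicator (A n) \<omega> * norm (V (Suc n) \<omega>) \<partial>M)
    \<le> (1 + U / (b / 2)) * exp (- (m / 2) * time \<gamma> (Suc n))" (is ?le)
proof -
  \<comment> \<open>The square root of the decay factor of the second moment: both summands of the
    bound are then of order \<open>e\<close>.\<close>
  define e where "e = exp (- (m / 2) * time \<gamma> (Suc n))"
  have "e > 0" by (simp add: e_def)
  have e2: "exp (- m * time \<gamma> (Suc n)) = e * e"
    by (simp add: e_def exp_add[symmetric])
  have AM_GM: "indicator (A n) \<omega> * norm (V (Suc n) \<omega>) \<le> e + (1 / e) * (indicator (A n) \<omega> * (norm (V (Suc n) \<omega>))\<^sup>2)" for \<omega>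
  proof -
    have "e * r \<le> e * (e + 1 / e * r\<^sup>2)" if "0 \<le> r" for r :: real
      using mult_le_sum_squares[of e r] \<open>e > 0\<close> that
      by (simp add: distrib_left power2_eq_square)
    then have "norm (V (Suc n) \<omega>) \<le> e + 1 / e * (norm (V (Suc n) \<omega>))\<^sup>2"
      using \<open>e > 0\<close> by (meson mult_le_cancel_left_pos norm_ge_zero)
    then show ?thesis using \<open>e > 0\<close> by (cases "\<omega> \<in> A n") auto
  qed
  have int: "integrable M (\<lambda>\<omega>. indicator (A n) \<omega> * (norm (V (Suc n) \<omega>))\<^sup>2)"
    by (intro integrable_indicator_mult L2_norm_integrable L2_V)
  then have int': "integrable M (\<lambda>\<omega>. e + (1 / e) * (indicator (A n) \<omega> * (norm (V (Suc n) \<omega>))\<^sup>2))"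
    by simp
  then show ?int
    by (rule Bochner_Integration.integrable_bound)
       (use AM_GM in \<open>auto intro: order_trans[OF _ abs_ge_self]\<close>)
  then have "(\<integral>\<omega>. indicator (A n) \<omega> * norm (V (Suc n) \<omega>) \<partial>M)
      \<le> (\<integral>\<omega>. e + (1 / e) * (indicator (A n) \<omega> * (norm (V (Suc n) \<omega>))\<^sup>2) \<partial>M)"
    using int' AM_GM by (intro integral_mono)
  also have "\<dots> = e + (1 / e) * (\<integral>\<omega>. indicator (A n) \<omega> * (norm (V (Suc n) \<omega>))\<^sup>2 \<partial>M)"
    using int by (simp add: prob_space)
  also have "\<dots> \<le> e + (1 / e) * (U / (b / 2) * (e * e))"
    using expected_V_decay[of n] \<open>e > 0\<close> unfolding e2 by (intro add_left_mono mult_left_mono) auto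
  also have "\<dots> = (1 + U / (b / 2)) * e" using \<open>e > 0\<close> by (simp add: field_simps)
  finally show ?le by (simp add: e_def)
qed

text \<open>The increments of \<open>X\<close> are absolutely summable almost surely: their means
  are bounded by step size times an exponential in time of rate \<open>m / 2\<close>, which is
  summable by \<open>summable_step_exp_time\<close>.\<close>

lemma X_convergent_AE: "AE \<omega> in M. \<omega> \<in> (\<Inter>n. A n) \<longrightarrow> convergent (\<lambda>n. X n \<omega>)"
proof -
  define u where "u n \<omega> = \<gamma> (Suc n) * (indicator (A n) \<omega> * norm (V (Suc n) \<omega>))" for n \<omega>
  have \<gamma>_pos: "0 < \<gamma> (Suc n)" for n using step_pos by simp
  have "AE \<omega> in M. summable (\<lambda>n. u n \<omega>)"
  proof (rule AE_summable_of_summable_integrals)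
    show "integrable M (u n)" for n
      unfolding u_def by (intro integrable_mult_right expected_norm_V_decay)
    show "0 \<le> u n \<omega>" for n \<omega> using \<gamma>_pos[of n] by (simp add: u_def)
    show "(\<integral>\<omega>. u n \<omega> \<partial>M) \<le> (1 + U / (b / 2)) * (\<gamma> (Suc n) * exp (- (m / 2) * time \<gamma> (Suc n)))" for n
      using mult_left_mono[OF expected_norm_V_decay(2)[of n], of "\<gamma> (Suc n)"] \<gamma>_pos[of n]
      by (simp add: u_def mult.left_commute)
    show "summable (\<lambda>n. (1 + U / (b / 2)) * (\<gamma> (Suc n) * exp (- (m / 2) * time \<gamma> (Suc n))))"
      using pos by (intro summable_mult summable_step_exp_time step_pos) auto
  qed
  \<comment> \<open>The countably many exceptional null sets of the recursion are united into
    one.\<close>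
  moreover have "AE \<omega> in M. \<forall>n. X (Suc n) \<omega> = X n \<omega> + \<gamma> (Suc n) *\<^sub>R V (Suc n) \<omega>"
    unfolding AE_all_countable using X_step by blast
  ultimately show ?thesis
  proof eventually_elim
    case (elim \<omega>)
    show ?case
    proof
      assume "\<omega> \<in> (\<Inter>n. A n)"
      then have "norm (\<gamma> (Suc n) *\<^sub>R V (Suc n) \<omega>) \<le> u n \<omega>" for n
        using \<gamma>_pos[of n] by (simp add: u_def)
      then have "summable (\<lambda>n. \<gamma> (Suc n) *\<^sub>R V (Suc n) \<omega>)"
        by (intro summable_comparison_test'[OF elim(1), of 0])
      then have "convergent (\<lambda>n. X 0 \<omega> + (\<Sum>i<n. \<gamma> (Suc i) *\<^sub>R V (Suc i) \<omega>))"
        unfolding summable_iff_convergent by (rule convergent_add[OF convergent_const])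
      also have "(\<lambda>n. X 0 \<omega> + (\<Sum>i<n. \<gamma> (Suc i) *\<^sub>R V (Suc i) \<omega>)) = (\<lambda>n. X n \<omega>)"
      proof
        show "X 0 \<omega> + (\<Sum>i<n. \<gamma> (Suc i) *\<^sub>R V (Suc i) \<omega>) = X n \<omega>" for n
        proof (induction n)
          case (Suc n)
          then show ?case using elim(2)[THEN spec, of n] by (simp add: add.assoc[symmetric])
        qed simp
      qed
      finally show "convergent (\<lambda>n. X n \<omega>)" .
    qed
  qed
qed

end

section \<open>Choice of the constants and conclusion\<close>

theorem theorem3p1:
  fixes f :: "real ^ 'd \<Rightarrow> real"
    and grad :: "real ^ 'd \<Rightarrow> real ^ 'd"
    and C\<^sub>L \<mu> L \<sigma> :: real
    and \<D> :: "(real ^ 'd) set"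
  assumes "\<And>x. GDERIV f x :> grad x"
    and "C\<^sub>L \<ge> 0"
    and "C\<^sub>L-lipschitz_on UNIV grad"
    and "bdd_below (range f)" and "(INF x. f x) = 0"
    and "\<mu> > 0"
    and "L > 0" and "\<sigma> \<ge> 0"
    and "open \<D>"
    and "\<And>x. x \<in> \<D> \<Longrightarrow> (norm (grad x))\<^sup>2 \<ge> 2 * L * f x"
  shows "\<exists>\<gamma>max>0. \<forall>(M :: 'w measure) F \<gamma> D X V.
    msgd M F grad \<mu> \<gamma> D X V \<longrightarrow>
    (\<forall>n. AE \<omega> in M. \<omega> \<in> stays_in M \<D> X n \<longrightarrow>
       real_cond_exp M (F n) (\<lambda>\<omega>'. (norm (D (Suc n) \<omega>'))\<^sup>2) \<omega> \<le> \<sigma> * f (X n \<omega>)) \<longrightarrow>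
    (SUP n\<in>{1..}. ereal (\<gamma> n)) \<le> ereal \<gamma>max \<longrightarrow>
    (\<exists>C>0. \<exists>m>0.
       (\<forall>n\<ge>1. integrable M (\<lambda>\<omega>. indicator (stays_in M \<D> X (n - 1)) \<omega> * f (X n \<omega>)) \<and>
          (\<integral>\<omega>. indicator (stays_in M \<D> X (n - 1)) \<omega> * f (X n \<omega>) \<partial>M)
            \<le> C * exp (- m * time \<gamma> n)) \<and>
       (\<forall>m'<m. summable (\<lambda>i. exp ((m' - m) * time \<gamma> i)) \<longrightarrow>
          (AE \<omega> in M. \<omega> \<in> (\<Inter>n. stays_in M \<D> X n) \<longrightarrow>
             (\<lambda>n. exp (m' * time \<gamma> n) * f (X n \<omega>)) \<longlonglongrightarrow> 0))) \<and>
    (AE \<omega> in M. \<omega> \<in> (\<Inter>n. stays_in M \<D> X n) \<longrightarrow> convergent (\<lambda>n. X n \<omega>))"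
proof -
  note gderiv = assms(1) and PL = assms(10)
  have nonneg: "f x \<ge> 0" for x
    using cINF_lower[OF assms(4), of x] assms(5) by simp
  \<comment> \<open>The Lipschitz constant may be 0; enlarging it by 1 makes the gradient step of
    length \<open>1 / K\<close> meaningful.\<close>
  define K where "K = C\<^sub>L + 1"
  have "K > 0" using assms(2) by (simp add: K_def)
  have lip: "K-lipschitz_on UNIV grad"
    using assms(3) by (rule lipschitz_on_mono) (auto simp: K_def)
  have grad_le: "(norm (grad x))\<^sup>2 \<le> 2 * K * f x" for x
    by (rule gderiv_lipschitz_norm_le[OF gderiv lip \<open>K > 0\<close> nonneg])
  \<comment> \<open>The summand \<open>K / \<mu>\<close> yields \<open>K < 2 * b * \<mu>\<close>;
    the summands 1 and \<open>K\<close> yield \<open>b \<ge> 1\<close> and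
    \<open>a \<ge> 2 * K\<close>, hence \<open>2 * K \<le> a * b\<close>.\<close>
  define b where "b = 1 + K + K / \<mu>"
  define a where "a = \<mu> + 2 * b"
  have b: "1 \<le> b" "K \<le> b" using \<open>K > 0\<close> \<open>\<mu> > 0\<close> by (auto simp: b_def)
  then have "b > 0" "a > 0" using \<open>\<mu> > 0\<close> by (auto simp: a_def)
  have gap: "K < 2 * b * \<mu>"
  proof -
    have "2 * b * \<mu> = 2 * (1 + K) * \<mu> + 2 * K" using \<open>\<mu> > 0\<close> by (simp add: b_def field_simps)
    moreover have "0 < 2 * (1 + K) * \<mu>" using \<open>K > 0\<close> \<open>\<mu> > 0\<close> by simp
    ultimately show ?thesis using \<open>K > 0\<close> by linarith
  qed
  have ab: "2 * K \<le> a * b"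
  proof -
    have "2 * K * 1 \<le> a * b"
      using b \<open>K > 0\<close> \<open>\<mu> > 0\<close> by (intro mult_mono) (auto simp: a_def)
    then show ?thesis by simp
  qed
  \<comment> \<open>Both constants are obtained before any process is introduced, so the step-size
    threshold is uniform over all probability spaces and processes.\<close>
  obtain m \<delta> where "m > 0" "\<delta> > 0" and drift:
    "\<And>\<gamma> \<phi> (g :: real ^ 'd) v. \<lbrakk>0 < \<gamma>; \<gamma> \<le> \<delta>; 0 \<le> \<phi>; 2 * L * \<phi> \<le> (norm g)\<^sup>2; (norm g)\<^sup>2 \<le> 2 * K * \<phi>\<rbrakk>
      \<Longrightarrow> a * \<phi> + (a * \<gamma> + 1) * (g \<bullet> ((1 - \<gamma> * \<mu>) *\<^sub>R v - \<gamma> *\<^sub>R g))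
            + (a * K / 2 * \<gamma>\<^sup>2 + K * \<gamma> + b)
              * ((norm ((1 - \<gamma> * \<mu>) *\<^sub>R v - \<gamma> *\<^sub>R g))\<^sup>2 + \<gamma>\<^sup>2 * (\<sigma> * \<phi>))
          \<le> (1 - m * \<gamma>) * lyapunov a b \<phi> g v"
    using lyapunov_drift[OF \<open>K > 0\<close> assms(6,7,8) \<open>b > 0\<close> a_def gap] by blast
  show ?thesis
  proof (rule exI[of _ \<delta>], intro conjI allI impI)
    fix M :: "'w measure" and F \<gamma> D X V
    assume "msgd M F grad \<mu> \<gamma> D X V"
      and noise_bound: "\<forall>n. AE \<omega> in M. \<omega> \<in> stays_in M \<D> X n \<longrightarrow>
        real_cond_exp M (F n) (\<lambda>\<omega>'. (norm (D (Suc n) \<omega>'))\<^sup>2) \<omega> \<le> \<sigma> * f (X n \<omega>)"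
      and "(SUP n\<in>{1..}. ereal (\<gamma> n)) \<le> ereal \<delta>"
    then interpret msgd M F grad \<mu> \<gamma> D X V by simp
    have step_le: "\<gamma> (Suc n) \<le> \<delta>" for n
      using \<open>(SUP n\<in>{1..}. ereal (\<gamma> n)) \<le> ereal \<delta>\<close> by (simp add: SUP_le_iff)
    interpret msgd_lyapunov M F grad \<mu> \<gamma> D X V f \<D> K \<sigma> a b m
    proof unfold_locales
      show "a / 2 * f x + b / 2 * (norm v)\<^sup>2 \<le> lyapunov a b (f x) (grad x) v" for x v
        by (rule lyapunov_lower[OF grad_le \<open>b > 0\<close> ab nonneg])
      show "AE \<omega> in M. \<omega> \<in> stays_in M \<D> X n \<longrightarrow>
          real_cond_exp M (F n) (\<lambda>\<omega>'. (norm (D (Suc n) \<omega>'))\<^sup>2) \<omega> \<le> \<sigma> * f (X n \<omega>)" for n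
        using noise_bound by (rule spec)
      show "a * f x + (a * \<gamma> (Suc n) + 1)
            * (grad x \<bullet> ((1 - \<gamma> (Suc n) * \<mu>) *\<^sub>R v - \<gamma> (Suc n) *\<^sub>R grad x))
          + (a * K / 2 * (\<gamma> (Suc n))\<^sup>2 + K * \<gamma> (Suc n) + b)
            * ((norm ((1 - \<gamma> (Suc n) * \<mu>) *\<^sub>R v - \<gamma> (Suc n) *\<^sub>R grad x))\<^sup>2
              + (\<gamma> (Suc n))\<^sup>2 * (\<sigma> * f x))
          \<le> (1 - m * \<gamma> (Suc n)) * lyapunov a b (f x) (grad x) v" if "x \<in> \<D>" for n x v
        using step_pos[of "Suc n"] by (intro drift step_le nonneg PL[OF that] grad_le) simp
    qed (fact gderiv lip nonneg assms(9) \<open>K > 0\<close> \<open>a > 0\<close> \<open>b > 0\<close> \<open>m > 0\<close>)+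
    show "AE \<omega> in M. \<omega> \<in> (\<Inter>n. stays_in M \<D> X n) \<longrightarrow> convergent (\<lambda>n. X n \<omega>)"
      by (rule X_convergent_AE)
    show "\<exists>C>0. \<exists>m>0.
       (\<forall>n\<ge>1. integrable M (\<lambda>\<omega>. indicator (stays_in M \<D> X (n - 1)) \<omega> * f (X n \<omega>)) \<and>
          (\<integral>\<omega>. indicator (stays_in M \<D> X (n - 1)) \<omega> * f (X n \<omega>) \<partial>M)
            \<le> C * exp (- m * time \<gamma> n)) \<and>
       (\<forall>m'<m. summable (\<lambda>i. exp ((m' - m) * time \<gamma> i)) \<longrightarrow>
          (AE \<omega> in M. \<omega> \<in> (\<Inter>n. stays_in M \<D> X n) \<longrightarrow>
             (\<lambda>n. exp (m' * time \<gamma> n) * f (X n \<omega>)) \<longlonglongrightarrow> 0))"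
    \<comment> \<open>The added 1 keeps the constant strictly positive when \<open>U\<close> is
      0.\<close>
    proof (rule exI[of _ "1 + U / (a / 2)"], rule conjI[OF _ exI[of _ m]], goal_cases)
      case 1
      show ?case using U_nonneg \<open>a > 0\<close> by (simp add: add_pos_nonneg)
    next
      case 2
      show ?case
      proof (intro conjI allI impI)
        show "m > 0" by fact
        fix n :: nat assume "1 \<le> n"
        \<comment> \<open>With \<open>n = Suc k\<close> the event with index \<open>n - 1\<close> is
          \<open>A k\<close>, the pairing of indices in \<open>expected_f_decay\<close>.\<close>
        then obtain k where n: "n = Suc k" by (cases n) auto
        show "integrable M (\<lambda>\<omega>. indicator (stays_in M \<D> X (n - 1)) \<omega> * f (X n \<omega>))"
          by (intro integrable_indicator_mult integrable_f)
        show "(\<integral>\<omega>. indicator (stays_in M \<D> X (n - 1)) \<omega> * f (X n \<omega>) \<partial>M)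
            \<le> (1 + U / (a / 2)) * exp (- m * time \<gamma> n)"
          using expected_f_decay[of k] by (simp add: n distrib_right add_increasing)
      next
        fix m' assume "summable (\<lambda>i. exp ((m' - m) * time \<gamma> i))"
        then show "AE \<omega> in M. \<omega> \<in> (\<Inter>n. stays_in M \<D> X n) \<longrightarrow>
            (\<lambda>n. exp (m' * time \<gamma> n) * f (X n \<omega>)) \<longlonglongrightarrow> 0"
          by (rule f_decay_AE)
      qed
    qed
  qed (rule \<open>\<delta> > 0\<close>)
qed

end
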